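(* Let $\mu,\nu$ be real parameters with $\mu>-\frac32$, and suppose that neither $\mu+\nu$ nor $\mu-\nu$ is an odd negative integer. Then the Lommel function $s_{\mu,\nu}$ has the integral representation $$s_{\mu,\nu}(z)=\frac{a_{\mu+2,\nu}}{(\mu+1)^2-\nu^2}\,z^{\mu+1}\int_0^1\cos(zt)\,f_{\mu+1,\nu}(t)\,dt=\frac{z^{\mu+1}}{a_{\mu+1,\nu}}\int_0^1\cos(zt)\,f_{\mu+1,\nu}(t)\,dt .$$
   Context: ${}_2F_1$ is the Gauss hypergeometric function. When neither $\mu+\nu$ nor $\mu-\nu$ is an odd negative integer, the Lommel function is $$s_{\mu,\nu}(z)=z^{\mu+1}\sum_{k=0}^\infty \frac{(-1)^k z^{2k}}{\prod_{j=0}^{k}\left((\mu+2j+1)^2-\nu^2\right)}=\frac{z^{\mu+1}}{(\mu+1)^2-\nu^2}\,{}_1F_2\left(1;\tfrac{\mu-\nu+3}{2},\tfrac{\mu+\nu+3}{2};-\tfrac{z^2}{4}\right),$$ a solution of $z^2y''+zy'+(z^2-\nu^2)y=z^{\mu+1}$; the same branch of $z^{\mu+1}$ is used on both sides of the claimed identity. The function $f_{\mu,\nu}$ is, for $\mu>-\frac12$ and $t\in[0,1)$, $$f_{\mu,\nu}(t)=(1-t)^{\mu-\frac12}\,\frac{{}_2F_1\left(\frac12+\nu,\frac12-\nu;\mu+\frac12;\frac{1-t}{2}\right)}{{}_2F_1\left(\frac12+\nu,\frac12-\nu;\mu+\frac12;\frac12\right)},$$ so $f_{\mu+1,\nu}$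 is this function with $\mu$ replaced by $\mu+1$, and $$a_{\mu,\nu}=2\,\frac{\Gamma\left(\frac{\mu+1+\nu}{2}\right)\Gamma\left(\frac{\mu+1-\nu}{2}\right)}{\Gamma\left(\frac{\mu+\nu}{2}\right)\Gamma\left(\frac{\mu-\nu}{2}\right)},$$ with the convention that $1/\Gamma$ vanishes at the poles of $\Gamma$. If $\mu+\nu$ or $\mu-\nu$ is an even negative integer, then the denominator of $f_{\mu+1,\nu}$ vanishes and $1/a_{\mu+1,\nu}=a_{\mu+2,\nu}/((\mu+1)^2-\nu^2)=0$; in that case the product $f_{\mu+1,\nu}(t)/a_{\mu+1,\nu}$ is read as its (finite) limit as $\nu$ tends to the given value. *)

theory Defs
  imports "HOL-Analysis.Analysis"
begin

definition odd_negative_integer :: "real \<Rightarrow> bool" where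
  "odd_negative_integer x \<longleftrightarrow> (\<exists>n::int. odd n \<and> n < 0 \<and> x = of_int n)"

definition even_negative_integer :: "real \<Rightarrow> bool" where
  "even_negative_integer x \<longleftrightarrow> (\<exists>n::int. even n \<and> n < 0 \<and> x = of_int n)"

text \<open>The values of the multivalued power \<open>z\<^sup>\<alpha>\<close>, one for each logarithm of \<open>z \<noteq> 0\<close>.
  At the branch point the power is 0 for \<open>\<alpha> > 0\<close>, it is 1 for \<open>\<alpha> = 0\<close>, and it has no
  value for \<open>\<alpha> < 0\<close>.\<close>

definition is_power_value :: "complex \<Rightarrow> real \<Rightarrow> complex \<Rightarrow> bool" where
  "is_power_value z \<alpha> w \<longleftrightarrow>
     (if z = 0 then (\<alpha> > 0 \<and> w = 0) \<or> (\<alpha> = 0 \<and> w = 1)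
      else \<exists>\<zeta>. exp \<zeta> = z \<and> w = exp (complex_of_real \<alpha> * \<zeta>))"

text \<open>The Lommel function \<open>s\<^bsub>\<mu>,\<nu>\<^esub>(z)\<close>. It is multivalued in \<open>z\<close>; the argument \<open>w\<close> is the chosen
  value of \<open>z\<close> to the power \<open>\<mu> + 1\<close>.\<close>

definition lommel_s :: "real \<Rightarrow> real \<Rightarrow> complex \<Rightarrow> complex \<Rightarrow> complex" where
  "lommel_s \<mu> \<nu> w z =
     w * (\<Sum>k. (-1) ^ k * z ^ (2 * k) /
               complex_of_real (\<Prod>j=0..k. ((\<mu> + 2 * real j + 1)\<^sup>2 - \<nu>\<^sup>2)))"

definition hyp2F1 :: "real \<Rightarrow> real \<Rightarrow> real \<Rightarrow> real \<Rightarrow> real" where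
  "hyp2F1 a b c x = eval_fps (fps_hypergeo [a, b] [c] 1) x"

lemma hyp2F1_series:
  "hyp2F1 a b c x =
     (\<Sum>n. pochhammer a n * pochhammer b n / (pochhammer c n * fact n) * x ^ n)"
  by (simp add: hyp2F1_def eval_fps_def fps_hypergeo_nth)

text \<open>Meaningful for \<open>\<mu> > -1/2\<close> and \<open>0 \<le> t < 1\<close>, as long as the denominator is nonzero.\<close>

definition lommel_f :: "real \<Rightarrow> real \<Rightarrow> real \<Rightarrow> real" where
  "lommel_f \<mu> \<nu> t =
     (1 - t) powr (\<mu> - 1/2) *
     (hyp2F1 (1/2 + \<nu>) (1/2 - \<nu>) (\<mu> + 1/2) ((1 - t) / 2) /
      hyp2F1 (1/2 + \<nu>) (1/2 - \<nu>) (\<mu> + 1/2) (1/2))"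

text \<open>The entire function \<open>rGamma\<close> is the reciprocal of \<open>\<Gamma>\<close> and vanishes at its poles. The
  value is meaningful only if neither Gamma factor is evaluated at a pole.\<close>

definition lommel_a :: "real \<Rightarrow> real \<Rightarrow> real" where
  "lommel_a \<mu> \<nu> =
     2 * (Gamma ((\<mu> + 1 + \<nu>) / 2) * Gamma ((\<mu> + 1 - \<nu>) / 2)) *
         (rGamma ((\<mu> + \<nu>) / 2) * rGamma ((\<mu> - \<nu>) / 2))"

end

theory Submission
  imports Defs
begin

text \<open>
  Write \<open>c = \<mu> + 3/2 > 0\<close>, \<open>p = (\<mu> + 1 + \<nu>)/2\<close> and \<open>q = (\<mu> + 1 - \<nu>)/2\<close>. Expanding the cosine
  turns the representation into a statement about even moments: the quotient
  \<open>f\<^bsub>\<mu>+1,\<nu>\<^esub>/a\<^bsub>\<mu>+1,\<nu>\<^esub>\<close> must have \<open>2k\<close>-th moment \<open>(2k)!\<close> divided by the \<open>k\<close>-th denominator of the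
  Lommel series, and that denominator is \<open>4\<^bsup>k+1\<^esup> (p)\<^bsub>k+1\<^esub> (q)\<^bsub>k+1\<^esub>\<close>.

  Integrating the Gauss series against \<open>t\<^bsup>m\<^esup> (1 - t)\<^bsup>c-1\<^esup>\<close> term by term, each term is a Beta integral
  whose only effect is to raise the lower parameter from \<open>c\<close> to \<open>c + m + 1\<close>
  (\<open>hyp2F1_moment\<close>). So all moments are values of the Gauss function with upper parameters
  \<open>1/2 + \<nu>\<close>, \<open>1/2 - \<nu>\<close> at the argument \<open>1/2\<close>. These upper parameters add up to 1, which is the
  situation of Bailey's theorem (\<open>bailey_hyp2F1_half\<close>): the value at \<open>1/2\<close> is a quotient of Gamma
  functions. The same theorem evaluates the normalising denominator of \<open>f\<close>, and after division
  only Pochhammer symbols remain.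

  Bailey's theorem is proved from contiguity. When the upper parameters add up to 1, the middle
  coefficient of the three-term relation in \<open>c\<close> carries a factor \<open>1 - 2 x\<close>; at \<open>x = 1/2\<close> the
  relation therefore connects \<open>c\<close> with \<open>c + 2\<close> alone (\<open>hyp2F1_half_contiguous\<close>). Iterating it,
  the Gauss function tends to 1 while the quotient of the accumulated Pochhammer symbols converges to
  a quotient of Gamma functions by Euler's limit formula.

  When \<open>\<mu> + \<nu>\<close> or \<open>\<mu> - \<nu>\<close> is an even negative integer, the denominator of \<open>f\<close> vanishes and \<open>a\<close> has
  a pole, but their product stays regular: it is a nonzero multiple of \<open>1/(\<Gamma>(p) \<Gamma>(q))\<close>. The quotient \<open>f/a\<close> is therefore
  replaced by \<open>lommel_kernel\<close>, in which this product is written out. The kernel agrees with \<open>f/a\<close>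
  away from the even negative integers, is continuous at the given \<open>\<nu>\<close>, and is hence the limit required in the
  exceptional case; the moment computation covers both cases at once.
\<close>

section \<open>The Gauss series\<close>

definition hyp2F1_term :: "real \<Rightarrow> real \<Rightarrow> real \<Rightarrow> real \<Rightarrow> nat \<Rightarrow> real" where
  "hyp2F1_term a b c x n =
     pochhammer a n * pochhammer b n / (pochhammer c n * fact n) * x ^ n"

lemma hyp2F1_term_0 [simp]: "hyp2F1_term a b c x 0 = 1"
  by (simp add: hyp2F1_term_def)

lemma hyp2F1_term_Suc:
  "hyp2F1_term a b c x (Suc n) =
     (a + real n) * (b + real n) / ((c + real n) * (1 + real n)) * x * hyp2F1_term a b c x n"
  by (simp add: hyp2F1_term_def pochhammer_Suc mult_ac)

text \<open>The factor that leads from one term to the next tends to \<open>x\<close>.\<close>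

lemma summable_hyp2F1_term:
  assumes "\<bar>x\<bar> < 1"
  shows "summable (\<lambda>n. \<bar>hyp2F1_term a b c x n\<bar>)"
proof -
  define r where "r = (\<lambda>n::nat. (a + real n) * (b + real n) / ((c + real n) * (1 + real n)) * x)"
  have lim1: "(\<lambda>n. 1 + q / real n) \<longlonglongrightarrow> 1 + 0" for q :: real
    by (intro tendsto_intros lim_const_over_n)
  have "(\<lambda>n. (1 + a / real n) * (1 + b / real n) /
          ((1 + c / real n) * (1 + 1 / real n)) * x) \<longlonglongrightarrow> (1 + 0) * (1 + 0) / ((1 + 0) * (1 + 0)) * x"
    by (intro tendsto_intros lim1) auto
  moreover have "\<forall>\<^sub>F n in sequentially. (1 + a / real n) * (1 + b / real n) /
          ((1 + c / real n) * (1 + 1 / real n)) * x = r n"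
    using eventually_gt_at_top[of 0]
  proof eventually_elim
    case (elim n)
    have s: "1 + q / real n = (q + real n) / real n" for q
      using elim by (simp add: field_simps)
    show ?case unfolding s r_def using elim by simp
  qed
  ultimately have "r \<longlonglongrightarrow> x"
    by (simp add: Lim_transform_eventually)
  then have "(\<lambda>n. \<bar>r n\<bar>) \<longlonglongrightarrow> \<bar>x\<bar>"
    by (rule tendsto_rabs)
  then have "\<forall>\<^sub>F n in sequentially. \<bar>r n\<bar> < (1 + \<bar>x\<bar>) / 2"
    using assms by (intro order_tendstoD) auto
  then obtain N where N: "\<And>n. n \<ge> N \<Longrightarrow> \<bar>r n\<bar> < (1 + \<bar>x\<bar>) / 2"
    by (auto simp: eventually_sequentially)
  show ?thesis
  proof (rule summable_ratio_test)
    show "(1 + \<bar>x\<bar>) / 2 < 1" using assms by simp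
    fix n assume "n \<ge> N"
    have "\<bar>hyp2F1_term a b c x (Suc n)\<bar> = \<bar>r n\<bar> * \<bar>hyp2F1_term a b c x n\<bar>"
      unfolding hyp2F1_term_Suc r_def by (simp only: abs_mult)
    also have "\<dots> \<le> (1 + \<bar>x\<bar>) / 2 * \<bar>hyp2F1_term a b c x n\<bar>"
      using N[OF \<open>n \<ge> N\<close>] by (intro mult_right_mono) auto
    finally show "norm \<bar>hyp2F1_term a b c x (Suc n)\<bar> \<le> (1 + \<bar>x\<bar>) / 2 * norm \<bar>hyp2F1_term a b c x n\<bar>"
      by simp
  qed
qed

lemma hyp2F1_sums:
  assumes "\<bar>x\<bar> < 1"
  shows "hyp2F1_term a b c x sums hyp2F1 a b c x"
  using summable_sums[OF summable_rabs_cancel[OF summable_hyp2F1_term[OF assms]]]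
  by (simp add: hyp2F1_series hyp2F1_term_def[abs_def])

text \<open>Raising \<open>c\<close> by \<open>m\<close> multiplies every factor of \<open>(c)\<^bsub>n\<^esub>\<close> by at least 1, and the first factor
  already gains \<open>(c + m)/c\<close>. The terms of positive index thus decay uniformly in \<open>n\<close>
  as \<open>m\<close> grows.\<close>

lemma hyp2F1_term_shift_le:
  fixes n m :: nat
  assumes c: "c > 0" and n: "n > 0"
  shows "\<bar>hyp2F1_term a b (c + real m) x n\<bar> \<le> c / (c + real m) * \<bar>hyp2F1_term a b c x n\<bar>"
proof -
  obtain k where k: "n = Suc k" using n by (cases n) auto
  have mono: "pochhammer (c + 1) k \<le> pochhammer (c + real m + 1) k"
    using c by (induction k) (auto simp: pochhammer_Suc intro!: mult_mono pochhammer_nonneg)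
  have pos: "pochhammer (c + 1) k > 0" "pochhammer (c + real m + 1) k > 0"
    using c by (auto intro!: pochhammer_pos)
  define A where "A = \<bar>pochhammer a n * pochhammer b n * x ^ n\<bar> / fact n"
  have eq: "\<bar>hyp2F1_term a b c' x n\<bar> = A / (c' * pochhammer (c' + 1) k)"
    if "c' > 0" for c'
  proof -
    have p: "pochhammer c' n = c' * pochhammer (c' + 1) k" "pochhammer (c' + 1) k > 0"
      using that by (auto simp: k pochhammer_rec intro!: pochhammer_pos)
    show ?thesis
      unfolding hyp2F1_term_def A_def p(1) using that p(2) by (simp add: abs_mult mult_ac)
  qed
  have "A / ((c + real m) * pochhammer (c + real m + 1) k) \<le> A / ((c + real m) * pochhammer (c + 1) k)"
    using c pos mono by (intro divide_left_mono mult_left_mono mult_pos_pos) (auto simp: A_def)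
  also have "\<dots> = c / (c + real m) * (A / (c * pochhammer (c + 1) k))"
    using c by simp
  finally show ?thesis using c by (simp add: eq)
qed

lemma hyp2F1_shift_tendsto_1:
  assumes c: "c > 0" and x: "\<bar>x\<bar> < 1"
  shows "(\<lambda>m. hyp2F1 a b (c + real m) x) \<longlonglongrightarrow> 1"
proof -
  define S where "S = (\<Sum>n. \<bar>hyp2F1_term a b c x (Suc n)\<bar>)"
  have sm: "summable (\<lambda>n. \<bar>hyp2F1_term a b c' x (Suc n)\<bar>)" for c'
    using summable_hyp2F1_term[OF x, of a b c'] by (subst summable_Suc_iff)
  have bound: "\<bar>hyp2F1 a b (c + real m) x - 1\<bar> \<le> S * (c / (c + real m))" for m :: nat
  proof -
    have "(\<lambda>n. hyp2F1_term a b (c + real m) x (Suc n)) sums (hyp2F1 a b (c + real m) x - 1)"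
      using hyp2F1_sums[OF x, of a b "c + real m"] by (simp add: sums_Suc_iff)
    then have "hyp2F1 a b (c + real m) x - 1 = (\<Sum>n. hyp2F1_term a b (c + real m) x (Suc n))"
      by (simp add: sums_iff)
    also have "\<bar>\<dots>\<bar> \<le> (\<Sum>n. \<bar>hyp2F1_term a b (c + real m) x (Suc n)\<bar>)"
      by (rule summable_rabs[OF sm])
    also have "\<dots> \<le> (\<Sum>n. c / (c + real m) * \<bar>hyp2F1_term a b c x (Suc n)\<bar>)"
      by (intro suminf_le hyp2F1_term_shift_le c sm summable_mult) auto
    also have "\<dots> = c / (c + real m) * S"
      unfolding S_def by (rule suminf_mult[OF sm])
    finally show ?thesis by (simp add: mult.commute)
  qed
  have "(\<lambda>m. c / (c + real m)) \<longlonglongrightarrow> 0"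
    by (intro tendsto_divide_0[OF tendsto_const] filterlim_at_top_imp_at_infinity
          filterlim_tendsto_add_at_top[OF tendsto_const] filterlim_real_sequentially)
  then have "(\<lambda>m. S * (c / (c + real m))) \<longlonglongrightarrow> 0"
    by (rule tendsto_mult_right_zero)
  then have "(\<lambda>m. hyp2F1 a b (c + real m) x - 1) \<longlonglongrightarrow> 0"
    by (rule Lim_null_comparison[rotated]) (use bound in simp)
  then show ?thesis by (simp add: LIM_zero_iff)
qed

section \<open>Bailey's evaluation at one half\<close>

text \<open>The identity holds by telescoping. With \<open>u\<^bsub>n\<^esub>\<close> and \<open>v\<^bsub>n\<^esub>\<close> the terms of the two series, expressing
  \<open>u\<^bsub>n\<^esub>\<close> through \<open>v\<^bsub>n\<^esub>\<close> gives
  \<open>c (c + 1) u\<^bsub>n\<^esub> - (c + a) (c + 1 - a) v\<^bsub>n\<^esub> = (n\<^sup>2 + 2 c n + n - a (1 - a)) v\<^bsub>n\<^esub>\<close>,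
  and this is the difference of consecutive values of \<open>T\<^bsub>n\<^esub> = - 2 n (c + 1 + n) v\<^bsub>n\<^esub>\<close>, which vanishes
  at \<open>n = 0\<close> and at infinity.\<close>

lemma hyp2F1_half_contiguous:
  assumes c: "c > 0"
  shows "c * (c + 1) * hyp2F1 a (1 - a) c (1/2) =
           (c + a) * (c + 1 - a) * hyp2F1 a (1 - a) (c + 2) (1/2)"
proof -
  define u v where "u = hyp2F1_term a (1 - a) c (1/2)" and "v = hyp2F1_term a (1 - a) (c + 2) (1/2)"
  define T where "T = (\<lambda>n. - 2 * (real n * (c + 1 + real n) * v n))"
  have uv: "c * (c + 1) * u n = (c + real n) * (c + 1 + real n) * v n" for n
  proof -
    have p: "pochhammer c n > 0" "pochhammer (c + 2) n > 0" using c by (auto intro: pochhammer_pos)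
    have "pochhammer c n * ((c + real n) * (c + 1 + real n)) = c * (c + 1) * pochhammer (c + 2) n"
      using pochhammer_product'[of c n 2] pochhammer_product'[of c 2 n]
      by (simp add: add.commute eval_nat_numeral pochhammer_Suc add_ac mult_ac)
    then have "c * (c + 1) / pochhammer c n = (c + real n) * (c + 1 + real n) / pochhammer (c + 2) n"
      using p by (subst frac_eq_eq) (auto simp: mult_ac)
    then have "c * (c + 1) / pochhammer c n * (pochhammer a n * pochhammer (1 - a) n / fact n * (1/2) ^ n) =
        (c + real n) * (c + 1 + real n) / pochhammer (c + 2) n *
          (pochhammer a n * pochhammer (1 - a) n / fact n * (1/2) ^ n)"
      by (rule arg_cong)
    then show ?thesis
      by (simp add: u_def v_def hyp2F1_term_def mult_ac)
  qed
  have step: "T (Suc n) - T n = c * (c + 1) * u n - (c + a) * (c + 1 - a) * v n" for n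
  proof -
    have "T (Suc n) = - ((a + real n) * (1 - a + real n)) * v n"
    proof -
      have "c + 2 + real n \<noteq> 0" using c by simp
      then show ?thesis
        unfolding T_def v_def hyp2F1_term_Suc by (simp add: divide_simps)
    qed
    then show ?thesis
      unfolding uv unfolding T_def by (simp add: algebra_simps)
  qed
  have half: "\<bar>1/2 :: real\<bar> < 1" by simp
  have "T \<longlonglongrightarrow> 0"
  proof -
    \<comment> \<open>Although \<open>T\<close> has a quadratic factor, it is a bounded multiple of \<open>u\<close>.\<close>
    have "u \<longlonglongrightarrow> 0"
      unfolding u_def using hyp2F1_sums[OF half] by (intro summable_LIMSEQ_zero) (auto simp: sums_iff)
    then have "(\<lambda>n. -2 * (c * (c + 1)) * (u n * (real n / (real n + c)))) \<longlonglongrightarrow> -2 * (c * (c + 1)) * (0 * 1)"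
    proof (intro tendsto_intros)
      have "(\<lambda>n. 1 / (1 + c / real n)) \<longlonglongrightarrow> 1 / (1 + 0)"
        by (intro tendsto_intros lim_const_over_n) auto
      moreover have "\<forall>\<^sub>F n in sequentially. 1 / (1 + c / real n) = real n / (real n + c)"
        using eventually_gt_at_top[of 0] by eventually_elim (use c in \<open>auto simp: divide_simps\<close>)
      ultimately show "(\<lambda>n. real n / (real n + c)) \<longlonglongrightarrow> 1"
        by (simp add: Lim_transform_eventually)
    qed
    moreover have "-2 * (c * (c + 1)) * (u n * (real n / (real n + c))) = T n" for n
    proof -
      have "-2 * (c * (c + 1)) * (u n * (real n / (real n + c)))
              = -2 * (c * (c + 1) * u n) * (real n / (real n + c))"
        by simp
      also have "\<dots> = T n"
        unfolding uv T_def using c by (simp add: divide_simps)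
      finally show ?thesis .
    qed
    ultimately show ?thesis by simp
  qed
  from telescope_sums[OF this]
  have "(\<lambda>n. c * (c + 1) * u n - (c + a) * (c + 1 - a) * v n) sums 0"
    by (simp add: step) (simp add: T_def)
  moreover have "(\<lambda>n. c * (c + 1) * u n - (c + a) * (c + 1 - a) * v n) sums
      (c * (c + 1) * hyp2F1 a (1 - a) c (1/2) -
        (c + a) * (c + 1 - a) * hyp2F1 a (1 - a) (c + 2) (1/2))"
    unfolding u_def v_def by (intro sums_diff sums_mult hyp2F1_sums half)
  ultimately show ?thesis by (simp add: sums_iff)
qed

lemma hyp2F1_half_iterate:
  assumes c: "c > 0"
  shows "pochhammer (c/2) n * pochhammer ((c + 1)/2) n * hyp2F1 a (1 - a) c (1/2) =
     pochhammer ((c + a)/2) n * pochhammer ((c + 1 - a)/2) n * hyp2F1 a (1 - a) (c + 2 * real n) (1/2)"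
proof (induction n)
  case (Suc n)
  define P Q where "P = pochhammer (c/2) n * pochhammer ((c + 1)/2) n"
    and "Q = pochhammer ((c + a)/2) n * pochhammer ((c + 1 - a)/2) n"
  define d where "d = c + 2 * real n"
  have d: "d > 0" using c by (simp add: d_def)
  have shift: "c + 2 * real (Suc n) = d + 2" by (simp add: d_def)
  have "pochhammer (c/2) (Suc n) * pochhammer ((c + 1)/2) (Suc n) * hyp2F1 a (1 - a) c (1/2)
          = (d * (d + 1) / 4) * (P * hyp2F1 a (1 - a) c (1/2))"
    by (simp add: pochhammer_Suc P_def d_def field_simps)
  also have "\<dots> = Q / 4 * (d * (d + 1) * hyp2F1 a (1 - a) d (1/2))"
    using Suc by (simp add: P_def Q_def d_def)
  also have "\<dots> = Q / 4 * ((d + a) * (d + 1 - a) * hyp2F1 a (1 - a) (d + 2) (1/2))"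
    by (simp only: hyp2F1_half_contiguous[OF d])
  also have "\<dots> = pochhammer ((c + a)/2) (Suc n) * pochhammer ((c + 1 - a)/2) (Suc n)
                    * hyp2F1 a (1 - a) (d + 2) (1/2)"
    by (simp add: pochhammer_Suc Q_def d_def field_simps)
  finally show ?case unfolding shift .
qed simp

text \<open>Multiplied by Euler's factors \<open>n\<^bsup>-s\<^esup>/n!\<close>, the Pochhammer symbols of the iterated relation become the
  approximants of \<open>1/\<Gamma>\<close>. The powers of \<open>n\<close> on both sides agree because
  \<open>c/2 + (c + 1)/2 = (c + a)/2 + (c + 1 - a)/2\<close>. Working with \<open>rGamma\<close> on the right keeps the case
  in which the Gauss function vanishes.\<close>

theorem bailey_hyp2F1_half:
  assumes c: "c > 0"
  shows "hyp2F1 a (1 - a) c (1/2) =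
           Gamma (c/2) * Gamma ((c + 1)/2) * (rGamma ((c + a)/2) * rGamma ((c + 1 - a)/2))"
proof -
  define F where "F = hyp2F1 a (1 - a) c (1/2)"
  define L where "L = (\<lambda>n. rGamma_series (c/2) n * rGamma_series ((c + 1)/2) n * F)"
  define R where "R = (\<lambda>n. rGamma_series ((c + a)/2) n * rGamma_series ((c + 1 - a)/2) n *
                            hyp2F1 a (1 - a) (c + 2 * real (n + 1)) (1/2))"
  have "L = R"
  proof
    fix n
    define E where "E = (\<lambda>s. exp (s * ln (real n)))"
    have E: "E (c/2) * E ((c + 1)/2) = E ((c + a)/2) * E ((c + 1 - a)/2)"
      unfolding E_def exp_add[symmetric] by (rule arg_cong[of _ _ exp]) (simp add: field_simps)
    have rG: "rGamma_series s n = pochhammer s (n + 1) / (fact n * E s)" for s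
      by (simp add: rGamma_series_def E_def)
    have "L n = pochhammer (c/2) (n + 1) * pochhammer ((c + 1)/2) (n + 1) * F /
                  (fact n * fact n * (E (c/2) * E ((c + 1)/2)))"
      by (simp add: L_def rG mult_ac)
    also have "\<dots> = R n"
      unfolding F_def hyp2F1_half_iterate[OF c] E R_def rG by (simp add: mult_ac)
    finally show "L n = R n" .
  qed
  have "L \<longlonglongrightarrow> rGamma (c/2) * rGamma ((c + 1)/2) * F"
    unfolding L_def by (intro tendsto_intros)
  moreover have "L \<longlonglongrightarrow> rGamma ((c + a)/2) * rGamma ((c + 1 - a)/2) * 1"
  proof -
    have "filterlim (\<lambda>n::nat. 2 * (n + 1)) at_top sequentially"
      by (rule filterlim_subseq) (auto simp: strict_mono_def)
    from filterlim_compose[OF hyp2F1_shift_tendsto_1[OF c, of "1/2" a "1 - a"] this]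
    have "(\<lambda>n. hyp2F1 a (1 - a) (c + 2 * real (n + 1)) (1/2)) \<longlonglongrightarrow> 1"
      by simp
    then show ?thesis
      unfolding \<open>L = R\<close> R_def by (intro tendsto_intros)
  qed
  ultimately have "rGamma (c/2) * rGamma ((c + 1)/2) * F = rGamma ((c + a)/2) * rGamma ((c + 1 - a)/2)"
    using LIMSEQ_unique by fastforce
  moreover have "Gamma (c/2) > 0" "Gamma ((c + 1)/2) > 0"
    using c by (auto intro: Gamma_real_pos)
  ultimately show ?thesis
    unfolding F_def rGamma_inverse_Gamma by (simp add: field_simps)
qed

section \<open>Moments and cosine transforms\<close>

text \<open>A form of dominated convergence for series: the majorants have the product form \<open>B n * h x\<close>, so
  the integrals of the norms are summable as soon as \<open>B\<close> is.\<close>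

lemma set_integral_series:
  fixes f :: "nat \<Rightarrow> 'a \<Rightarrow> 'b::{banach, second_countable_topology}" and h :: "'a \<Rightarrow> real"
  assumes f: "\<And>n. set_integrable M A (f n)" and h: "set_integrable M A h"
    and sums: "\<And>x. x \<in> A \<Longrightarrow> (\<lambda>n. f n x) sums S x"
    and bound: "\<And>n x. x \<in> A \<Longrightarrow> norm (f n x) \<le> B n * h x"
    and B: "summable B"
  shows "set_integrable M A S" and "(\<lambda>n. LINT x:A|M. f n x) sums (LINT x:A|M. S x)"
proof -
  define F where "F = (\<lambda>n x. indicator A x *\<^sub>R f n x)"
  have Fbound: "norm (F n x) \<le> B n * (indicator A x *\<^sub>R h x)" for n x
    using bound by (auto simp: F_def indicator_def)
  have F: "integrable M (F n)" for n
    using f by (simp add: F_def set_integrable_def)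
  have AE: "AE x in M. summable (\<lambda>n. norm (F n x))"
    by (rule AE_I2, rule summable_comparison_test'[OF summable_mult2[OF B]]) (use Fbound in simp)
  have int: "summable (\<lambda>n. \<integral>x. norm (F n x) \<partial>M)"
  proof (rule summable_comparison_test'[OF summable_mult2[OF B]])
    fix n
    have "(\<integral>x. norm (F n x) \<partial>M) \<le> (\<integral>x. B n * (indicator A x *\<^sub>R h x) \<partial>M)"
      using h by (intro integral_mono Fbound integrable_norm F integrable_mult_right)
                 (auto simp: set_integrable_def)
    then show "norm (\<integral>x. norm (F n x) \<partial>M) \<le> B n * (LINT x:A|M. h x)"
      by (simp add: set_lebesgue_integral_def)
  qed
  have S: "(\<Sum>n. F n x) = indicator A x *\<^sub>R S x" for x
    using sums by (auto simp: F_def indicator_def sums_iff)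
  show "set_integrable M A S"
    using integrable_suminf[OF F AE int] by (simp add: S set_integrable_def)
  show "(\<lambda>n. LINT x:A|M. f n x) sums (LINT x:A|M. S x)"
    using sums_integral[OF F AE int, unfolded S] by (simp add: F_def set_lebesgue_integral_def)
qed

lemma beta_moment:
  fixes c :: real
  assumes c: "c > 0"
  shows "set_integrable lborel {0..<1} (\<lambda>t. t ^ m * (1 - t) powr (c - 1))"
    and "(LINT t:{0..<1}|lborel. t ^ m * (1 - t) powr (c - 1)) = fact m / pochhammer c (m + 1)"
proof -
  define f where "f = (\<lambda>t::real. t powr (real (m + 1) - 1) * (1 - t) powr (c - 1))"
  define g where "g = (\<lambda>t::real. t ^ m * (1 - t) powr (c - 1))"
  have f: "set_integrable lborel {0..1} f"
    unfolding f_def using c by (intro integrable_Beta) auto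
  have fg: "f t = g t" if "t \<in> {0<..<1}" for t
    using that by (simp add: f_def g_def powr_realpow)
  have "set_integrable lborel {0<..<1} f"
    by (rule set_integrable_subset[OF f]) auto
  also have "set_integrable lborel {0<..<1} f = set_integrable lborel {0<..<1} g"
    using fg by (intro set_integrable_cong) auto
  finally have g: "set_integrable lborel {0<..<1} g" .
  \<comment> \<open>In the Beta integral \<open>t powr 0\<close> vanishes at \<open>t = 0\<close>, unlike \<open>t ^ 0\<close>; the endpoints form a null set.\<close>
  have diff: "set_integrable lborel {0<..<1} g = set_integrable lborel {0..<1} g"
    by (rule set_integrable_discrete_difference[where X = "{0}"]) auto
  then show "set_integrable lborel {0..<1} (\<lambda>t. t ^ m * (1 - t) powr (c - 1))"
    using g by (simp add: g_def)
  have "(LINT t:{0..<1}|lborel. g t) = (LINT t:{0<..<1}|lborel. g t)"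
    by (rule set_integral_discrete_difference[where X = "{0}"]) auto
  also have "\<dots> = (LINT t:{0<..<1}|lborel. f t)"
    using fg by (intro set_lebesgue_integral_cong) auto
  also have "\<dots> = (LINT t:{0..1}|lborel. f t)"
    by (rule set_integral_discrete_difference[where X = "{0, 1}"]) auto
  also have "\<dots> = Beta (real (m + 1)) c"
    using set_borel_integral_eq_integral(2)[OF f] has_integral_Beta_real[of "real (m + 1)" c] c
    unfolding f_def by (simp add: integral_unique)
  also have "\<dots> = fact m * Gamma c / Gamma (c + real (m + 1))"
    using Gamma_fact[of m, where 'a = real] by (simp add: Beta_def add_ac)
  also have "\<dots> = fact m / pochhammer c (m + 1)"
    using c by (subst pochhammer_Gamma) auto
  finally show "(LINT t:{0..<1}|lborel. t ^ m * (1 - t) powr (c - 1)) = fact m / pochhammer c (m + 1)"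
    by (simp add: g_def)
qed

text \<open>The \<open>n\<close>-th term of the Gauss series carries \<open>(1 - t)\<^bsup>n\<^esup>\<close>, so its integral is a Beta value
  \<open>m!/(c + n)\<^bsub>m+1\<^esub>\<close>. Since \<open>(c)\<^bsub>n\<^esub> (c + n)\<^bsub>m+1\<^esub> = (c)\<^bsub>m+1\<^esub> (c + m + 1)\<^bsub>n\<^esub>\<close>, summing over \<open>n\<close>
  again produces a Gauss series, with lower parameter \<open>c + m + 1\<close>.\<close>

lemma hyp2F1_moment:
  assumes c: "c > 0" and x: "\<bar>x\<bar> < 1"
  shows "set_integrable lborel {0..<1} (\<lambda>t. t ^ m * ((1 - t) powr (c - 1) * hyp2F1 a b c ((1 - t) * x)))"
    and "(LINT t:{0..<1}|lborel. t ^ m * ((1 - t) powr (c - 1) * hyp2F1 a b c ((1 - t) * x))) =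
           fact m / pochhammer c (m + 1) * hyp2F1 a b (c + real (m + 1)) x"
proof -
  define q where "q = hyp2F1_term a b c x"
  define f where "f = (\<lambda>n t. q n * (t ^ m * (1 - t) powr (c + real n - 1)))"
  define S where "S = (\<lambda>t. t ^ m * ((1 - t) powr (c - 1) * hyp2F1 a b c ((1 - t) * x)))"
  have f_eq: "f n t = t ^ m * ((1 - t) powr (c - 1) * hyp2F1_term a b c ((1 - t) * x) n)"
    if "t \<in> {0..<1}" for n t
  proof -
    have "(1 - t) powr (c + real n - 1) = (1 - t) powr (c - 1) * (1 - t) ^ n"
      using that by (simp add: powr_realpow[symmetric] powr_add[symmetric] algebra_simps)
    then show ?thesis
      by (simp add: f_def q_def hyp2F1_term_def power_mult_distrib)
  qed
  have cn: "c + real n > 0" for n using c by simp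
  have int: "set_integrable lborel {0..<1} (f n)" for n
    unfolding f_def by (intro set_integrable_mult_right beta_moment(1) cn)
  have sums: "(\<lambda>n. f n t) sums S t" if t: "t \<in> {0..<1}" for t
  proof -
    have "\<bar>(1 - t) * x\<bar> \<le> 1 * \<bar>x\<bar>"
      unfolding abs_mult using t by (intro mult_right_mono) auto
    then show ?thesis
      using x unfolding f_eq[OF t] S_def by (intro sums_mult hyp2F1_sums) auto
  qed
  have bound: "norm (f n t) \<le> \<bar>q n\<bar> * (t ^ m * (1 - t) powr (c - 1))" if t: "t \<in> {0..<1}" for n t
  proof -
    have "(1 - t) powr (c + real n - 1) \<le> (1 - t) powr (c - 1)"
      using t by (intro powr_mono') auto
    then show ?thesis
      using t by (auto simp: f_def abs_mult intro!: mult_left_mono)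
  qed
  have sm: "summable (\<lambda>n. \<bar>q n\<bar>)"
    unfolding q_def by (rule summable_hyp2F1_term[OF x])
  note series = set_integral_series[OF int beta_moment(1)[OF c] sums bound sm]
  show "set_integrable lborel {0..<1} (\<lambda>t. t ^ m * ((1 - t) powr (c - 1) * hyp2F1 a b c ((1 - t) * x)))"
    using series(1) by (simp add: S_def)
  have "(LINT t:{0..<1}|lborel. f n t) =
          fact m / pochhammer c (m + 1) * hyp2F1_term a b (c + real (m + 1)) x n" for n
  proof -
    have "pochhammer c n * pochhammer (c + real n) (m + 1) =
            pochhammer c (m + 1) * pochhammer (c + real (m + 1)) n"
      using pochhammer_product'[of c n "m + 1"] pochhammer_product'[of c "m + 1" n]
      by (simp add: add.commute)
    moreover have "(LINT t:{0..<1}|lborel. f n t) = q n * (fact m / pochhammer (c + real n) (m + 1))"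
      unfolding f_def by (simp only: set_integral_mult_right beta_moment(2)[OF cn])
    moreover have "q n * (fact m / pochhammer (c + real n) (m + 1)) =
        pochhammer a n * pochhammer b n / fact n * x ^ n * fact m /
          (pochhammer c n * pochhammer (c + real n) (m + 1))"
      by (simp add: q_def hyp2F1_term_def mult_ac)
    ultimately show ?thesis
      by (simp only: hyp2F1_term_def) (simp add: mult_ac)
  qed
  then have "(\<lambda>n. fact m / pochhammer c (m + 1) * hyp2F1_term a b (c + real (m + 1)) x n)
               sums (LINT t:{0..<1}|lborel. S t)"
    using series(2) by simp
  moreover have "(\<lambda>n. fact m / pochhammer c (m + 1) * hyp2F1_term a b (c + real (m + 1)) x n)
      sums (fact m / pochhammer c (m + 1) * hyp2F1 a b (c + real (m + 1)) x)"
    by (intro sums_mult hyp2F1_sums x)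
  ultimately show "(LINT t:{0..<1}|lborel. t ^ m * ((1 - t) powr (c - 1) * hyp2F1 a b c ((1 - t) * x))) =
           fact m / pochhammer c (m + 1) * hyp2F1 a b (c + real (m + 1)) x"
    by (simp add: S_def sums_iff)
qed

lemma cos_transform_sums:
  fixes g :: "real \<Rightarrow> real" and z :: complex
  assumes g: "set_integrable lborel {0..<1} g"
  shows "set_integrable lborel {0..<1} (\<lambda>t. cos (z * of_real t) * of_real (g t))"
    and "(\<lambda>k. (-1) ^ k * z ^ (2 * k) *
             of_real ((LINT t:{0..<1}|lborel. t ^ (2 * k) * g t) / fact (2 * k)))
           sums (LINT t:{0..<1}|lborel. cos (z * of_real t) * of_real (g t))"
proof -
  define f where "f = (\<lambda>n t. (of_real (cos_coeff n) * z ^ n) * complex_of_real (t ^ n * g t))"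
  have moment: "set_integrable lborel {0..<1} (\<lambda>t. t ^ n * g t)" for n
  proof (rule set_integrable_bound[OF g])
    have "(\<lambda>t. t ^ n * (indicat_real {0..<1} t *\<^sub>R g t)) \<in> borel_measurable lborel"
      using g unfolding set_integrable_def by (intro borel_measurable_times) auto
    then show "set_borel_measurable lborel {0..<1} (\<lambda>t. t ^ n * g t)"
      by (simp add: set_borel_measurable_def mult_ac)
    show "AE t in lborel. t \<in> {0..<1} \<longrightarrow> norm (t ^ n * g t) \<le> norm (g t)"
      by (rule AE_I2) (auto simp: abs_mult intro!: mult_left_le_one_le power_le_one)
  qed
  have int: "set_integrable lborel {0..<1} (f n)" for n
    unfolding f_def
  proof (rule set_integrable_mult_right)
    show "set_integrable lborel {0..<1} (\<lambda>t. complex_of_real (t ^ n * g t))"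
      using integrable_of_real[OF moment[of n, unfolded set_integrable_def], where 'a = complex]
      by (simp add: set_integrable_def scaleR_conv_of_real)
  qed
  have sums: "(\<lambda>n. f n t) sums (cos (z * of_real t) * of_real (g t))" for t
    using sums_mult2[OF cos_converges[of "z * of_real t"], of "of_real (g t)"]
    by (simp add: f_def scaleR_conv_of_real power_mult_distrib mult_ac)
  have bound: "norm (f n t) \<le> norm z ^ n / fact n * \<bar>g t\<bar>" if t: "t \<in> {0..<1}" for n t
  proof -
    have "\<bar>cos_coeff n\<bar> \<le> 1 / fact n"
      by (simp add: cos_coeff_def abs_mult power_abs divide_simps)
    moreover have "\<bar>t ^ n * g t\<bar> \<le> \<bar>g t\<bar>"
      using t by (auto simp: abs_mult intro!: mult_left_le_one_le power_le_one)
    ultimately have "\<bar>cos_coeff n\<bar> * norm z ^ n * \<bar>t ^ n * g t\<bar> \<le> 1 / fact n * norm z ^ n * \<bar>g t\<bar>"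
      by (intro mult_mono) auto
    then show ?thesis
      unfolding f_def norm_mult norm_power norm_of_real by simp
  qed
  have sm: "summable (\<lambda>n. norm z ^ n / fact n)"
    using summable_exp[of "norm z"] by (simp add: field_simps)
  note series = set_integral_series[OF int set_integrable_abs[OF g] sums bound sm]
  show "set_integrable lborel {0..<1} (\<lambda>t. cos (z * of_real t) * of_real (g t))"
    by (rule series(1))
  have f_int: "(LINT t:{0..<1}|lborel. f n t) =
      of_real (cos_coeff n) * z ^ n * of_real (LINT t:{0..<1}|lborel. t ^ n * g t)" for n
    unfolding f_def set_integral_mult_right set_integral_complex_of_real ..
  have "(\<lambda>k. LINT t:{0..<1}|lborel. f (2 * k) t)
           sums (LINT t:{0..<1}|lborel. cos (z * of_real t) * of_real (g t))"
  \<comment> \<open>The cosine series has only even powers, so the odd moments drop out.\<close>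
  proof (subst sums_mono_reindex[where g = "\<lambda>k. 2 * k"])
    show "strict_mono (\<lambda>k::nat. 2 * k)" by (simp add: strict_mono_def)
    fix n assume "n \<notin> range (\<lambda>k::nat. 2 * k)"
    then have "odd n" by (auto elim!: evenE)
    then show "(LINT t:{0..<1}|lborel. f n t) = 0"
      by (simp add: f_int cos_coeff_def)
  qed (rule series(2))
  then show "(\<lambda>k. (-1) ^ k * z ^ (2 * k) *
             of_real ((LINT t:{0..<1}|lborel. t ^ (2 * k) * g t) / fact (2 * k)))
           sums (LINT t:{0..<1}|lborel. cos (z * of_real t) * of_real (g t))"
    unfolding f_int by (simp add: cos_coeff_def mult_ac)
qed

section \<open>The Lommel kernel and its moments\<close>

text \<open>The denominator is the closed form of the product of \<open>a\<^bsub>\<mu>+1,\<nu>\<^esub>\<close> and the normalising denominator of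
  \<open>f\<^bsub>\<mu>+1,\<nu>\<^esub>\<close>: the factors that are singular or zero when \<open>\<mu> + \<nu>\<close> or \<open>\<mu> - \<nu>\<close> is an even negative
  integer cancel in it.\<close>

definition lommel_kernel :: "real \<Rightarrow> real \<Rightarrow> real \<Rightarrow> real" where
  "lommel_kernel \<mu> \<nu> t =
     (1 - t) powr (\<mu> + 1/2) * hyp2F1 (1/2 + \<nu>) (1/2 - \<nu>) (\<mu> + 3/2) ((1 - t) / 2) /
     (2 * Gamma ((\<mu> + 3/2) / 2) * Gamma ((\<mu> + 5/2) / 2) *
        (rGamma ((\<mu> + 1 + \<nu>) / 2) * rGamma ((\<mu> + 1 - \<nu>) / 2)))"

lemma rGamma_half_nonzero_if_not_odd:
  assumes "\<not> odd_negative_integer x"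
  shows "rGamma ((x + 1) / 2) \<noteq> 0"
proof
  assume "rGamma ((x + 1) / 2) = 0"
  then obtain n where "(x + 1) / 2 = - real n"
    by (auto simp: rGamma_eq_zero_iff elim!: nonpos_Ints_cases')
  then have "x = of_int (- 2 * int n - 1)"
    by (simp add: field_simps)
  moreover have "odd (- 2 * int n - 1)" "- 2 * int n - 1 < 0"
    by auto
  ultimately show False
    using assms unfolding odd_negative_integer_def by blast
qed

lemma rGamma_half_nonzero_if_not_even:
  assumes "\<not> even_negative_integer x"
  shows "rGamma ((x + 2) / 2) \<noteq> 0"
proof
  assume "rGamma ((x + 2) / 2) = 0"
  then obtain n where "(x + 2) / 2 = - real n"
    by (auto simp: rGamma_eq_zero_iff elim!: nonpos_Ints_cases')
  then have "x = of_int (- 2 * int n - 2)"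
    by (simp add: field_simps)
  moreover have "even (- 2 * int n - 2)" "- 2 * int n - 2 < 0"
    by auto
  ultimately show False
    using assms unfolding even_negative_integer_def by blast
qed

text \<open>Each factor is a difference of squares and splits as \<open>4 (p + j) (q + j)\<close>.\<close>

lemma lommel_denominator_pochhammer:
  fixes \<mu> \<nu> :: real
  shows "(\<Prod>j=0..k. (\<mu> + 2 * real j + 1)\<^sup>2 - \<nu>\<^sup>2) =
     4 ^ (k + 1) * (pochhammer ((\<mu> + 1 + \<nu>) / 2) (k + 1) * pochhammer ((\<mu> + 1 - \<nu>) / 2) (k + 1))"
proof -
  have "(\<Prod>j=0..k. (\<mu> + 2 * real j + 1)\<^sup>2 - \<nu>\<^sup>2) =
        (\<Prod>j=0..k. 4 * (((\<mu> + 1 + \<nu>) / 2 + real j) * ((\<mu> + 1 - \<nu>) / 2 + real j)))"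
    by (intro prod.cong) (auto simp: field_simps power2_eq_square)
  then show ?thesis
    by (simp add: prod.distrib pochhammer_Suc_prod)
qed

lemma pochhammer_double_odd:
  fixes c :: real
  shows "pochhammer c (2 * k + 1) =
     2 ^ (2 * k + 1) * (pochhammer (c / 2) (k + 1) * pochhammer ((c + 1) / 2) k)"
proof (induction k)
  case (Suc k)
  have "pochhammer c (2 * Suc k + 1) =
          pochhammer c (2 * k + 1) * ((c + real (2 * k + 1)) * (c + real (2 * k + 2)))"
    by (simp add: pochhammer_Suc mult_ac add_ac)
  then show ?case
    unfolding Suc by (simp add: pochhammer_Suc field_simps)
qed simp

text \<open>For \<open>m = 2 k\<close> the lower parameter becomes \<open>c + 2 k + 1\<close>. Because this shift is odd, the two
  numerator arguments \<open>c/2\<close> and \<open>(c + 1)/2\<close> in Bailey's formula change places, up to integers: they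
  become \<open>(c + 1)/2 + k\<close> and \<open>c/2 + k + 1\<close>, while the denominator arguments become \<open>p + k + 1\<close> and
  \<open>q + k + 1\<close>. Relative to the normalising constant all Gamma functions thus reduce to Pochhammer
  symbols, and those in \<open>c\<close> cancel by the duplication formula.\<close>

lemma lommel_kernel_moment:
  assumes \<mu>: "\<mu> > -3/2"
    and p: "\<not> odd_negative_integer (\<mu> + \<nu>)" and q: "\<not> odd_negative_integer (\<mu> - \<nu>)"
  shows "set_integrable lborel {0..<1} (lommel_kernel \<mu> \<nu>)"
    and "(LINT t:{0..<1}|lborel. t ^ (2 * k) * lommel_kernel \<mu> \<nu> t) =
           fact (2 * k) / (\<Prod>j=0..k. (\<mu> + 2 * real j + 1)\<^sup>2 - \<nu>\<^sup>2)"
proof -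
  define c where "c = \<mu> + 3/2"
  define P Q where "P = (\<mu> + 1 + \<nu>) / 2" and "Q = (\<mu> + 1 - \<nu>) / 2"
  define N where "N = 2 * Gamma (c / 2) * Gamma ((c + 1) / 2) * (rGamma P * rGamma Q)"
  define h where "h = (\<lambda>t. (1 - t) powr (c - 1) * hyp2F1 (1/2 + \<nu>) (1/2 - \<nu>) c ((1 - t) * (1/2)))"
  have c: "c > 0" using \<mu> by (simp add: c_def)
  have ker: "lommel_kernel \<mu> \<nu> = (\<lambda>t. h t / N)"
    by (intro ext) (simp add: lommel_kernel_def h_def N_def c_def P_def Q_def add_ac)
  note moment = hyp2F1_moment[OF c, of "1/2" _ "1/2 + \<nu>" "1/2 - \<nu>", folded h_def]
  show "set_integrable lborel {0..<1} (lommel_kernel \<mu> \<nu>)"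
    unfolding ker using moment(1)[of 0] by (intro set_integrable_divide) (simp_all add: h_def)
  have rGnz: "rGamma P \<noteq> 0" "rGamma Q \<noteq> 0"
    using rGamma_half_nonzero_if_not_odd[OF p] rGamma_half_nonzero_if_not_odd[OF q]
    by (simp_all add: P_def Q_def algebra_simps)
  have Gpos: "Gamma (c / 2) > 0" "Gamma ((c + 1) / 2) > 0"
    using c by (auto intro: Gamma_real_pos)
  define A B where "A = pochhammer (c / 2) (k + 1)" and "B = pochhammer ((c + 1) / 2) k"
  define P' Q' where "P' = rGamma (P + real (k + 1))" and "Q' = rGamma (Q + real (k + 1))"
  have AB: "A > 0" "B > 0" using c by (auto simp: A_def B_def intro!: pochhammer_pos)
  have rP: "rGamma P = pochhammer P (k + 1) * P'" and rQ: "rGamma Q = pochhammer Q (k + 1) * Q'"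
    unfolding P'_def Q'_def by (rule pochhammer_rGamma)+
  have nz: "pochhammer P (k + 1) \<noteq> 0" "pochhammer Q (k + 1) \<noteq> 0" "P' \<noteq> 0" "Q' \<noteq> 0"
    using rGnz unfolding rP rQ by auto
  have G1: "Gamma (c / 2 + real (k + 1)) = A * Gamma (c / 2)"
  proof -
    have "A = Gamma (c / 2 + real (k + 1)) / Gamma (c / 2)"
      unfolding A_def by (rule pochhammer_Gamma) (use c in auto)
    then show ?thesis
      using Gpos(1) by (metis less_irrefl nonzero_divide_eq_eq)
  qed
  have G2: "Gamma ((c + 1) / 2 + real k) = B * Gamma ((c + 1) / 2)"
  proof -
    have "B = Gamma ((c + 1) / 2 + real (k)) / Gamma ((c + 1) / 2)"
      unfolding B_def by (rule pochhammer_Gamma) (use c in auto)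
    then show ?thesis
      using Gpos(2) by (metis less_irrefl nonzero_divide_eq_eq)
  qed
  have ck: "c + real (2 * k + 1) > 0" using c by simp
  have args: "(c + real (2 * k + 1)) / 2 = (c + 1) / 2 + real k"
      "(c + real (2 * k + 1) + 1) / 2 = c / 2 + real (k + 1)"
      "(c + real (2 * k + 1) + (1/2 + \<nu>)) / 2 = P + real (k + 1)"
      "(c + real (2 * k + 1) + 1 - (1/2 + \<nu>)) / 2 = Q + real (k + 1)"
    by (auto simp: c_def P_def Q_def field_simps)
  have F: "hyp2F1 (1/2 + \<nu>) (1/2 - \<nu>) (c + real (2 * k + 1)) (1/2) =
        B * Gamma ((c + 1) / 2) * (A * Gamma (c / 2)) * (P' * Q')"
    using bailey_hyp2F1_half[OF ck, of "1/2 + \<nu>"] unfolding args G1 G2 P'_def Q'_def by simp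
  have "(LINT t:{0..<1}|lborel. t ^ (2 * k) * lommel_kernel \<mu> \<nu> t) =
          (LINT t:{0..<1}|lborel. t ^ (2 * k) * h t) / N"
    unfolding ker by (simp add: times_divide_eq_right)
  also have "(LINT t:{0..<1}|lborel. t ^ (2 * k) * h t) =
      fact (2 * k) / pochhammer c (2 * k + 1) *
        hyp2F1 (1/2 + \<nu>) (1/2 - \<nu>) (c + real (2 * k + 1)) (1/2)"
    unfolding h_def by (rule hyp2F1_moment(2)[OF c]) simp
  also have "\<dots> / N = fact (2 * k) / (4 ^ (k + 1) * (pochhammer P (k + 1) * pochhammer Q (k + 1)))"
  proof -
    have pw: "2 ^ (2 * k + 1) * 2 = (4::real) ^ (k + 1)"
      by (simp add: power_mult)
    have "fact (2 * k) / (2 ^ (2 * k + 1) * (A * B)) *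
            (B * Gamma ((c + 1) / 2) * (A * Gamma (c / 2)) * (P' * Q')) /
          (2 * Gamma (c / 2) * Gamma ((c + 1) / 2) *
             ((pochhammer P (k + 1) * P') * (pochhammer Q (k + 1) * Q'))) =
        fact (2 * k) / ((2 ^ (2 * k + 1) * 2) * (pochhammer P (k + 1) * pochhammer Q (k + 1)))"
      using AB Gpos nz by (simp add: divide_simps del: power_Suc power_add)
    then show ?thesis
      unfolding F N_def rP rQ pochhammer_double_odd A_def[symmetric] B_def[symmetric] pw .
  qed
  also have "\<dots> = fact (2 * k) / (\<Prod>j=0..k. (\<mu> + 2 * real j + 1)\<^sup>2 - \<nu>\<^sup>2)"
    unfolding lommel_denominator_pochhammer P_def Q_def ..
  finally show "(LINT t:{0..<1}|lborel. t ^ (2 * k) * lommel_kernel \<mu> \<nu> t) =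
           fact (2 * k) / (\<Prod>j=0..k. (\<mu> + 2 * real j + 1)\<^sup>2 - \<nu>\<^sup>2)" .
qed

theorem lommel_s_cosine_transform:
  fixes z w :: complex
  assumes \<mu>: "\<mu> > -3/2"
    and p: "\<not> odd_negative_integer (\<mu> + \<nu>)" and q: "\<not> odd_negative_integer (\<mu> - \<nu>)"
  shows "set_integrable lborel {0..<1} (\<lambda>t. cos (z * of_real t) * of_real (lommel_kernel \<mu> \<nu> t))"
    and "lommel_s \<mu> \<nu> w z =
           w * (LINT t:{0..<1}|lborel. cos (z * of_real t) * of_real (lommel_kernel \<mu> \<nu> t))"
proof -
  note ker = lommel_kernel_moment[OF \<mu> p q]
  show "set_integrable lborel {0..<1} (\<lambda>t. cos (z * of_real t) * of_real (lommel_kernel \<mu> \<nu> t))"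
    by (rule cos_transform_sums(1)[OF ker(1)])
  have "(\<lambda>k. (-1) ^ k * z ^ (2 * k) /
           complex_of_real (\<Prod>j=0..k. (\<mu> + 2 * real j + 1)\<^sup>2 - \<nu>\<^sup>2))
        sums (LINT t:{0..<1}|lborel. cos (z * of_real t) * of_real (lommel_kernel \<mu> \<nu> t))"
    using cos_transform_sums(2)[OF ker(1), of z] unfolding ker(2) by simp
  then show "lommel_s \<mu> \<nu> w z =
           w * (LINT t:{0..<1}|lborel. cos (z * of_real t) * of_real (lommel_kernel \<mu> \<nu> t))"
    unfolding lommel_s_def by (simp only: sums_iff)
qed

text \<open>This is \<open>\<Gamma>(p + 1) \<Gamma>(q + 1) = p q \<Gamma>(p) \<Gamma>(q)\<close> with \<open>4 p q = (\<mu> + 1)\<^sup>2 - \<nu>\<^sup>2\<close>. It makes the two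
  forms of the representation equivalent.\<close>

lemma lommel_a_recurrence:
  assumes p: "\<not> odd_negative_integer (\<mu> + \<nu>)" and q: "\<not> odd_negative_integer (\<mu> - \<nu>)"
  shows "lommel_a (\<mu> + 2) \<nu> / ((\<mu> + 1)\<^sup>2 - \<nu>\<^sup>2) = 1 / lommel_a (\<mu> + 1) \<nu>"
proof -
  define P Q where "P = (\<mu> + 1 + \<nu>) / 2" and "Q = (\<mu> + 1 - \<nu>) / 2"
  have nz: "rGamma P \<noteq> 0" "rGamma Q \<noteq> 0"
    using rGamma_half_nonzero_if_not_odd[OF p] rGamma_half_nonzero_if_not_odd[OF q]
    by (simp_all add: P_def Q_def algebra_simps)
  then have notin: "P \<notin> \<int>\<^sub>\<le>\<^sub>0" "Q \<notin> \<int>\<^sub>\<le>\<^sub>0" by (auto simp: rGamma_eq_zero_iff)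
  then have PQ: "P \<noteq> 0" "Q \<noteq> 0" by auto
  have a2: "lommel_a (\<mu> + 2) \<nu> =
      2 * (Gamma (P + 1) * Gamma (Q + 1)) * (rGamma (P + 1/2) * rGamma (Q + 1/2))"
    by (simp add: lommel_a_def P_def Q_def field_simps)
  have a1: "lommel_a (\<mu> + 1) \<nu> =
      2 * (Gamma (P + 1/2) * Gamma (Q + 1/2)) * (rGamma P * rGamma Q)"
    by (simp add: lommel_a_def P_def Q_def field_simps)
  have "(\<mu> + 1)\<^sup>2 - \<nu>\<^sup>2 = 4 * (P * Q)"
    by (simp add: P_def Q_def field_simps power2_eq_square)
  then show ?thesis
    unfolding a1 a2 Gamma_plus1[OF notin(1)] Gamma_plus1[OF notin(2)]
    using PQ by (simp add: rGamma_inverse_Gamma field_simps)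
qed

lemma lommel_a_nonzero:
  assumes p: "\<not> odd_negative_integer (\<mu> + \<nu>)" and q: "\<not> odd_negative_integer (\<mu> - \<nu>)"
    and p': "\<not> even_negative_integer (\<mu> + \<nu>)" and q': "\<not> even_negative_integer (\<mu> - \<nu>)"
  shows "lommel_a (\<mu> + 1) \<nu> \<noteq> 0"
  using rGamma_half_nonzero_if_not_odd[OF p] rGamma_half_nonzero_if_not_odd[OF q]
    rGamma_half_nonzero_if_not_even[OF p'] rGamma_half_nonzero_if_not_even[OF q']
  by (simp add: lommel_a_def rGamma_inverse_Gamma algebra_simps)

text \<open>Bailey's theorem gives the normalising denominator of \<open>f\<close> the factor
  \<open>1/(\<Gamma>(p + 1/2) \<Gamma>(q + 1/2))\<close>, which cancels against \<open>a\<close>. The cancellation is legitimate exactly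
  when neither argument is a pole, that is, when no even negative integer occurs.\<close>

lemma lommel_f_divide_lommel_a:
  assumes \<mu>: "\<mu> > -3/2"
    and p: "\<not> even_negative_integer (\<mu> + \<nu>)" and q: "\<not> even_negative_integer (\<mu> - \<nu>)"
  shows "lommel_f (\<mu> + 1) \<nu> t / lommel_a (\<mu> + 1) \<nu> = lommel_kernel \<mu> \<nu> t"
proof -
  define c where "c = \<mu> + 3/2"
  define X Y where "X = (\<mu> + 2 + \<nu>) / 2" and "Y = (\<mu> + 2 - \<nu>) / 2"
  have c: "c > 0" using \<mu> by (simp add: c_def)
  have nz: "rGamma X \<noteq> 0" "rGamma Y \<noteq> 0"
    using rGamma_half_nonzero_if_not_even[OF p] rGamma_half_nonzero_if_not_even[OF q]
    by (simp_all add: X_def Y_def algebra_simps)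
  have args: "(c + (1/2 + \<nu>)) / 2 = X" "(c + 1 - (1/2 + \<nu>)) / 2 = Y"
    by (simp_all add: c_def X_def Y_def)
  have F: "hyp2F1 (1/2 + \<nu>) (1/2 - \<nu>) c (1/2) =
      Gamma (c / 2) * Gamma ((c + 1) / 2) * (rGamma X * rGamma Y)"
    using bailey_hyp2F1_half[OF c, of "1/2 + \<nu>"] unfolding args by simp
  have a: "lommel_a (\<mu> + 1) \<nu> = 2 * (inverse (rGamma X) * inverse (rGamma Y)) *
      (rGamma ((\<mu> + 1 + \<nu>) / 2) * rGamma ((\<mu> + 1 - \<nu>) / 2))"
    by (simp add: lommel_a_def X_def Y_def rGamma_inverse_Gamma add_ac)
  have "hyp2F1 (1/2 + \<nu>) (1/2 - \<nu>) c (1/2) * lommel_a (\<mu> + 1) \<nu> =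
      2 * Gamma (c / 2) * Gamma ((c + 1) / 2) *
        (rGamma ((\<mu> + 1 + \<nu>) / 2) * rGamma ((\<mu> + 1 - \<nu>) / 2))"
    unfolding F a using nz by (simp add: field_simps)
  moreover have "lommel_f (\<mu> + 1) \<nu> t / lommel_a (\<mu> + 1) \<nu> =
      (1 - t) powr (\<mu> + 1/2) * hyp2F1 (1/2 + \<nu>) (1/2 - \<nu>) c ((1 - t) / 2) /
        (hyp2F1 (1/2 + \<nu>) (1/2 - \<nu>) c (1/2) * lommel_a (\<mu> + 1) \<nu>)"
    by (simp add: lommel_f_def c_def add_ac)
  ultimately show ?thesis
    by (simp add: lommel_kernel_def c_def add_ac)
qed

section \<open>Dependence on the order\<close>

lemma abs_pochhammer_le:
  fixes a A :: real
  assumes "\<bar>a\<bar> \<le> A"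
  shows "\<bar>pochhammer a n\<bar> \<le> pochhammer A n"
proof (induction n)
  case (Suc n)
  have "\<bar>a + real n\<bar> \<le> A + real n" using assms by linarith
  then show ?case
    using Suc by (simp add: pochhammer_Suc abs_mult mult_mono')
qed simp

text \<open>For orders \<open>s\<close> within distance 1 of \<open>\<nu>\<close> both upper parameters are at most \<open>\<bar>\<nu>\<bar> + 3/2\<close> in modulus,
  and the Gauss series with that number as both upper parameters is a common majorant.\<close>

lemma isCont_hyp2F1_order:
  assumes c: "c > 0" and x: "\<bar>x\<bar> < 1"
  shows "isCont (\<lambda>s. hyp2F1 (1/2 + s) (1/2 - s) c x) \<nu>"
proof -
  define R where "R = \<bar>\<nu>\<bar> + 3/2"
  define I where "I = {\<nu> - 1<..<\<nu> + 1}"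
  have pos: "pochhammer c n > 0" for n using c by (rule pochhammer_pos)
  have "uniform_limit I (\<lambda>n s. \<Sum>i<n. hyp2F1_term (1/2 + s) (1/2 - s) c x i)
          (\<lambda>s. \<Sum>i. hyp2F1_term (1/2 + s) (1/2 - s) c x i) sequentially"
  proof (rule Weierstrass_m_test)
    fix n s assume "s \<in> I"
    then have "\<bar>1/2 + s\<bar> \<le> R" "\<bar>1/2 - s\<bar> \<le> R"
      by (auto simp: I_def R_def)
    then have "\<bar>pochhammer (1/2 + s) n\<bar> * \<bar>pochhammer (1/2 - s) n\<bar> \<le> pochhammer R n * pochhammer R n"
      by (intro mult_mono abs_pochhammer_le) (auto simp: R_def intro!: pochhammer_nonneg)
    then show "norm (hyp2F1_term (1/2 + s) (1/2 - s) c x n) \<le> hyp2F1_term R R c \<bar>x\<bar> n"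
      using pos[of n]
      by (auto simp: hyp2F1_term_def abs_mult power_abs intro!: mult_right_mono divide_right_mono)
  next
    show "summable (hyp2F1_term R R c \<bar>x\<bar>)"
      using hyp2F1_sums[of "\<bar>x\<bar>" R R c] x by (simp add: sums_iff)
  qed
  moreover have "continuous_on I (\<lambda>s. \<Sum>i<n. hyp2F1_term (1/2 + s) (1/2 - s) c x i)" for n
    using pos unfolding hyp2F1_term_def pochhammer_prod
    by (intro continuous_intros) (auto simp: pochhammer_prod less_imp_neq[THEN not_sym])
  ultimately have "continuous_on I (\<lambda>s. \<Sum>i. hyp2F1_term (1/2 + s) (1/2 - s) c x i)"
    by (intro uniform_limit_theorem[OF always_eventually]) auto
  also have "(\<lambda>s. \<Sum>i. hyp2F1_term (1/2 + s) (1/2 - s) c x i) = (\<lambda>s. hyp2F1 (1/2 + s) (1/2 - s) c x)"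
    by (simp add: hyp2F1_series hyp2F1_term_def)
  finally have "continuous_on I (\<lambda>s. hyp2F1 (1/2 + s) (1/2 - s) c x)" .
  then show ?thesis
    by (subst (asm) continuous_on_eq_continuous_at) (auto simp: I_def)
qed

lemma lommel_kernel_tendsto:
  assumes \<mu>: "\<mu> > -3/2"
    and p: "\<not> odd_negative_integer (\<mu> + \<nu>)" and q: "\<not> odd_negative_integer (\<mu> - \<nu>)"
    and t: "t \<in> {0..<1}"
  shows "((\<lambda>s. lommel_kernel \<mu> s t) \<longlongrightarrow> lommel_kernel \<mu> \<nu> t) (at \<nu>)"
proof -
  have "\<bar>(1 - t) / 2\<bar> < 1" using t by auto
  then have F: "isCont (\<lambda>s. hyp2F1 (1/2 + s) (1/2 - s) (\<mu> + 3/2) ((1 - t) / 2)) \<nu>"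
    using \<mu> by (intro isCont_hyp2F1_order) auto
  have "Gamma ((\<mu> + 3/2) / 2) > 0" "Gamma ((\<mu> + 5/2) / 2) > 0"
    using \<mu> by (auto intro: Gamma_real_pos)
  moreover have "rGamma ((\<mu> + 1 + \<nu>) / 2) \<noteq> 0" "rGamma ((\<mu> + 1 - \<nu>) / 2) \<noteq> 0"
    using rGamma_half_nonzero_if_not_odd[OF p] rGamma_half_nonzero_if_not_odd[OF q]
    by (simp_all add: algebra_simps)
  ultimately have "isCont (\<lambda>s. lommel_kernel \<mu> s t) \<nu>"
    unfolding lommel_kernel_def by (intro continuous_intros F) auto
  then show ?thesis by (simp add: isCont_def)
qed

lemma eventually_at_not_Ints: "\<forall>\<^sub>F y in at x. (y :: real) \<notin> \<int>"
proof -
  have "open (- (\<int> - {x}))"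
    by (intro open_Compl closed_subset_Ints) auto
  then have "\<forall>\<^sub>F y in at x. y \<in> - (\<int> - {x})"
    by (intro eventually_at_in_open') auto
  moreover have "\<forall>\<^sub>F y in at x. y \<noteq> x"
    by (rule eventually_neq_at_within)
  ultimately show ?thesis
    by eventually_elim auto
qed

text \<open>The closed form of \<open>f/a\<close> is available on a punctured neighbourhood of every order: there
  \<open>\<mu> + s\<close> and \<open>\<mu> - s\<close> avoid the integers altogether.\<close>

lemma eventually_regular_order:
  fixes \<mu> \<nu> :: real
  shows "\<forall>\<^sub>F s in at \<nu>. \<mu> + s \<notin> \<int> \<and> \<mu> - s \<notin> \<int>"
proof -
  have "filterlim (\<lambda>s. \<mu> + s) (at (\<mu> + \<nu>)) (at \<nu>)"
    by (rule filterlim_atI) (auto intro!: tendsto_intros eventually_neq_at_within simp: eventually_at_filter)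
  moreover have "filterlim (\<lambda>s. \<mu> - s) (at (\<mu> - \<nu>)) (at \<nu>)"
    by (rule filterlim_atI) (auto intro!: tendsto_intros simp: eventually_at_filter)
  ultimately show ?thesis
    using eventually_at_not_Ints[of "\<mu> + \<nu>"] eventually_at_not_Ints[of "\<mu> - \<nu>"]
    by (auto simp: filterlim_iff intro!: eventually_conj)
qed

theorem proposition3p7:
  fixes \<mu> \<nu> :: real and z w :: complex
  assumes "\<mu> > -3/2"
    and "\<not> odd_negative_integer (\<mu> + \<nu>)"
    and "\<not> odd_negative_integer (\<mu> - \<nu>)"
    and "is_power_value z (\<mu> + 1) w"
  shows
    "(\<not> even_negative_integer (\<mu> + \<nu>) \<and> \<not> even_negative_integer (\<mu> - \<nu>) \<longrightarrow>
        set_integrable lborel {0..<1}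
          (\<lambda>t. cos (z * complex_of_real t) * complex_of_real (lommel_f (\<mu> + 1) \<nu> t)) \<and>
        lommel_s \<mu> \<nu> w z =
          complex_of_real (lommel_a (\<mu> + 2) \<nu> / ((\<mu> + 1)\<^sup>2 - \<nu>\<^sup>2)) * w *
          (LINT t:{0..<1}|lborel.
             cos (z * complex_of_real t) * complex_of_real (lommel_f (\<mu> + 1) \<nu> t)) \<and>
        lommel_s \<mu> \<nu> w z =
          w / complex_of_real (lommel_a (\<mu> + 1) \<nu>) *
          (LINT t:{0..<1}|lborel.
             cos (z * complex_of_real t) * complex_of_real (lommel_f (\<mu> + 1) \<nu> t)))
     \<and>
     (even_negative_integer (\<mu> + \<nu>) \<or> even_negative_integer (\<mu> - \<nu>) \<longrightarrow>
        (\<exists>g :: real \<Rightarrow> real.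
          (\<forall>t\<in>{0..<1}.
             ((\<lambda>\<nu>'. lommel_a (\<mu> + 2) \<nu>' / ((\<mu> + 1)\<^sup>2 - \<nu>'\<^sup>2) * lommel_f (\<mu> + 1) \<nu>' t)
                \<longlongrightarrow> g t) (at \<nu>) \<and>
             ((\<lambda>\<nu>'. lommel_f (\<mu> + 1) \<nu>' t / lommel_a (\<mu> + 1) \<nu>') \<longlongrightarrow> g t) (at \<nu>)) \<and>
          set_integrable lborel {0..<1}
            (\<lambda>t. cos (z * complex_of_real t) * complex_of_real (g t)) \<and>
          lommel_s \<mu> \<nu> w z =
            w * (LINT t:{0..<1}|lborel. cos (z * complex_of_real t) * complex_of_real (g t))))"
proof (rule conjI; rule impI)
  note \<mu> = assms(1) and odd = assms(2,3)
  note transform = lommel_s_cosine_transform[OF \<mu> odd]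
  {
    assume even: "\<not> even_negative_integer (\<mu> + \<nu>) \<and> \<not> even_negative_integer (\<mu> - \<nu>)"
    define a where "a = lommel_a (\<mu> + 1) \<nu>"
    define I where "I = (LINT t:{0..<1}|lborel.
        cos (z * complex_of_real t) * complex_of_real (lommel_f (\<mu> + 1) \<nu> t))"
    have a: "a \<noteq> 0"
      unfolding a_def using even by (intro lommel_a_nonzero odd) auto
    have ker: "lommel_kernel \<mu> \<nu> t = lommel_f (\<mu> + 1) \<nu> t / a" for t
      unfolding a_def using even by (intro lommel_f_divide_lommel_a[OF \<mu>, symmetric]) auto
    have int: "set_integrable lborel {0..<1}
        (\<lambda>t. cos (z * complex_of_real t) * complex_of_real (lommel_f (\<mu> + 1) \<nu> t))"
      using transform(1)[of z] a by (simp add: ker)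
    have "lommel_s \<mu> \<nu> w z = w / complex_of_real a * I"
      using transform(2)[of w z] by (simp add: ker I_def)
    moreover have "complex_of_real (lommel_a (\<mu> + 2) \<nu> / ((\<mu> + 1)\<^sup>2 - \<nu>\<^sup>2)) * w = w / complex_of_real a"
      unfolding lommel_a_recurrence[OF odd] a_def by simp
    ultimately show "set_integrable lborel {0..<1}
          (\<lambda>t. cos (z * complex_of_real t) * complex_of_real (lommel_f (\<mu> + 1) \<nu> t)) \<and>
        lommel_s \<mu> \<nu> w z =
          complex_of_real (lommel_a (\<mu> + 2) \<nu> / ((\<mu> + 1)\<^sup>2 - \<nu>\<^sup>2)) * w *
          (LINT t:{0..<1}|lborel.
             cos (z * complex_of_real t) * complex_of_real (lommel_f (\<mu> + 1) \<nu> t)) \<and>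
        lommel_s \<mu> \<nu> w z =
          w / complex_of_real (lommel_a (\<mu> + 1) \<nu>) *
          (LINT t:{0..<1}|lborel.
             cos (z * complex_of_real t) * complex_of_real (lommel_f (\<mu> + 1) \<nu> t))"
      using int by (simp add: I_def a_def)
  next
    have reg: "\<forall>\<^sub>F s in at \<nu>. \<not> odd_negative_integer (\<mu> + s) \<and> \<not> odd_negative_integer (\<mu> - s) \<and>
        \<not> even_negative_integer (\<mu> + s) \<and> \<not> even_negative_integer (\<mu> - s)"
      using eventually_regular_order[of \<mu> \<nu>]
      by eventually_elim (auto simp: odd_negative_integer_def even_negative_integer_def)
    have lim2: "((\<lambda>s. lommel_f (\<mu> + 1) s t / lommel_a (\<mu> + 1) s) \<longlongrightarrow> lommel_kernel \<mu> \<nu> t) (at \<nu>)"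
      if "t \<in> {0..<1}" for t
    proof (rule Lim_transform_eventually[OF lommel_kernel_tendsto[OF \<mu> odd that]])
      show "\<forall>\<^sub>F s in at \<nu>. lommel_kernel \<mu> s t = lommel_f (\<mu> + 1) s t / lommel_a (\<mu> + 1) s"
        using reg by eventually_elim (simp add: lommel_f_divide_lommel_a[OF \<mu>])
    qed
    have lim1: "((\<lambda>s. lommel_a (\<mu> + 2) s / ((\<mu> + 1)\<^sup>2 - s\<^sup>2) * lommel_f (\<mu> + 1) s t)
        \<longlongrightarrow> lommel_kernel \<mu> \<nu> t) (at \<nu>)" if "t \<in> {0..<1}" for t
    proof (rule Lim_transform_eventually[OF lim2[OF that]])
      show "\<forall>\<^sub>F s in at \<nu>. lommel_f (\<mu> + 1) s t / lommel_a (\<mu> + 1) s =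
          lommel_a (\<mu> + 2) s / ((\<mu> + 1)\<^sup>2 - s\<^sup>2) * lommel_f (\<mu> + 1) s t"
        using reg by eventually_elim (subst lommel_a_recurrence, auto)
    qed
    show "\<exists>g :: real \<Rightarrow> real.
          (\<forall>t\<in>{0..<1}.
             ((\<lambda>\<nu>'. lommel_a (\<mu> + 2) \<nu>' / ((\<mu> + 1)\<^sup>2 - \<nu>'\<^sup>2) * lommel_f (\<mu> + 1) \<nu>' t)
                \<longlongrightarrow> g t) (at \<nu>) \<and>
             ((\<lambda>\<nu>'. lommel_f (\<mu> + 1) \<nu>' t / lommel_a (\<mu> + 1) \<nu>') \<longlongrightarrow> g t) (at \<nu>)) \<and>
          set_integrable lborel {0..<1}
            (\<lambda>t. cos (z * complex_of_real t) * complex_of_real (g t)) \<and>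
          lommel_s \<mu> \<nu> w z =
            w * (LINT t:{0..<1}|lborel. cos (z * complex_of_real t) * complex_of_real (g t))"
      using lim1 lim2 transform by (intro exI[of _ "lommel_kernel \<mu> \<nu>"]) blast
  }
qed

end
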